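(* Let $M=\operatorname{Mon}\langle\Sigma\mid R\rangle$ be a finitely presented monoid and let $\Re$ be a complete, reduced and cyclically complete rewriting system over $\Sigma$ for $M$. Let $u$ and $v$ be words in $\Sigma^{*}$, with cyclically irreducible forms $\rho(u)$ and $\rho(v)$. (i) If $u$ and $v$ are transposed, then $\rho(u)\bumpeq\rho(v)$. (ii) If $\rho(u)\bumpeq\rho(v)$, then $u\equiv_{M}v$.
   Context: A rewriting system $\Re$ over $\Sigma$ is a (possibly infinite) set of pairs (rules) $l\rightarrow r$ in $\Sigma^{*}\times\Sigma^{*}$; one writes $plq\rightarrow prq$ for a rule $l\rightarrow r$ and words $p,q$, and $\rightarrow^{*}$ is the reflexive transitive closure. It is a rewriting system for $M$ if the congruence on $\Sigma^{*}$ generated by $\Re$ is equality in $M$, written $=_{M}$. It is complete if it is terminating (no infinite chain of $\rightarrow$) and confluent; reduced if for every rule $l\rightarrow r$ the word $r$ is irreducible and no other rule has its left-hand side a subword of $l$. Two words $u,v$ are cyclic conjugates, written $u\bumpeq v$, if $u=pq$ and $v=qp$ in $\Sigma^{*}$ for some words $p,q$ (possibly empty). One writes $u\looparrowright v$ ($u$ cyclically reduces to $v$) if there is $\widetilde u\bumpeq u$ with $\widetilde u\rightarrow v$ (one rewriting step); $\looparrowright^{*}$ is the reflexive transitive closure of $\looparrowright$. $\Re$ is cyclically terminating if there is no infinite sequence $u_1\looparrowright u_2\looparrowright\cdots$. $\Re$ is cyclically confluent if whenever $w\looparrowright^{*}u$ and $w\looparrowright^{*}v$ there are words $z\bumpeq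 z'$ with $u\looparrowright^{*}z$ and $v\looparrowright^{*}z'$. $\Re$ is cyclically complete if it is both cyclically terminating and cyclically confluent. A word is cyclically irreducible if it and all its cyclic conjugates are irreducible for $\rightarrow$. A cyclically irreducible form of $u$, denoted $\rho(u)$, is a cyclically irreducible word $v$ with $u\looparrowright^{*}v$, considered up to $\bumpeq$; when $\Re$ is cyclically complete it exists and is unique up to $\bumpeq$. Words $u,v$ are transposed if there are $x,y\in\Sigma^{*}$ with $u=_{M}xy$ and $v=_{M}yx$. One writes $u\equiv_{M}v$ if there are $x,y\in\Sigma^{*}$ with $ux=_{M}xv$ and $yu=_{M}vy$. *)

theory Defs
  imports Main "HOL-Library.Sublist"
begin

inductive_set gen_cong :: "'a set \<Rightarrow> ('a list \<times> 'a list) set \<Rightarrow> ('a list \<times> 'a list) set"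
  for A :: "'a set" and R :: "('a list \<times> 'a list) set" where
  base: "(l, r) \<in> R \<Longrightarrow> l \<in> lists A \<Longrightarrow> r \<in> lists A \<Longrightarrow> (l, r) \<in> gen_cong A R"
| refl: "w \<in> lists A \<Longrightarrow> (w, w) \<in> gen_cong A R"
| sym: "(u, v) \<in> gen_cong A R \<Longrightarrow> (v, u) \<in> gen_cong A R"
| trans: "(u, v) \<in> gen_cong A R \<Longrightarrow> (v, w) \<in> gen_cong A R \<Longrightarrow> (u, w) \<in> gen_cong A R"
| mult: "(u, v) \<in> gen_cong A R \<Longrightarrow> (u', v') \<in> gen_cong A R \<Longrightarrow> (u @ u', v @ v') \<in> gen_cong A R"

definition finite_presentation :: "'a set \<Rightarrow> ('a list \<times> 'a list) set \<Rightarrow> bool" where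
  "finite_presentation A R \<longleftrightarrow> finite A \<and> finite R \<and> R \<subseteq> lists A \<times> lists A"

text \<open>Equality of words in the monoid \<open>M\<close> presented by generators \<open>A\<close> and relations \<open>R\<close>.\<close>

definition eq_mon :: "'a set \<Rightarrow> ('a list \<times> 'a list) set \<Rightarrow> 'a list \<Rightarrow> 'a list \<Rightarrow> bool" where
  "eq_mon A R u v \<longleftrightarrow> (u, v) \<in> gen_cong A R"

definition rewriting_system_for ::
    "'a set \<Rightarrow> ('a list \<times> 'a list) set \<Rightarrow> ('a list \<times> 'a list) set \<Rightarrow> bool" where
  "rewriting_system_for A R S \<longleftrightarrow>
     S \<subseteq> lists A \<times> lists A \<and> (\<forall>u v. (u, v) \<in> gen_cong A S \<longleftrightarrow> eq_mon A R u v)"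

definition rstep :: "'a set \<Rightarrow> ('a list \<times> 'a list) set \<Rightarrow> 'a list \<Rightarrow> 'a list \<Rightarrow> bool" where
  "rstep A S u v \<longleftrightarrow>
     (\<exists>l r. \<exists>p\<in>lists A. \<exists>q\<in>lists A. (l, r) \<in> S \<and> u = p @ l @ q \<and> v = p @ r @ q)"

definition irreducible_word :: "'a set \<Rightarrow> ('a list \<times> 'a list) set \<Rightarrow> 'a list \<Rightarrow> bool" where
  "irreducible_word A S w \<longleftrightarrow> \<not> (\<exists>v. rstep A S w v)"

definition terminating :: "'a set \<Rightarrow> ('a list \<times> 'a list) set \<Rightarrow> bool" where
  "terminating A S \<longleftrightarrow> \<not> (\<exists>f :: nat \<Rightarrow> 'a list. \<forall>i. rstep A S (f i) (f (Suc i)))"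

definition confluent :: "'a set \<Rightarrow> ('a list \<times> 'a list) set \<Rightarrow> bool" where
  "confluent A S \<longleftrightarrow>
     (\<forall>w\<in>lists A. \<forall>u v. (rstep A S)\<^sup>*\<^sup>* w u \<and> (rstep A S)\<^sup>*\<^sup>* w v \<longrightarrow>
        (\<exists>z. (rstep A S)\<^sup>*\<^sup>* u z \<and> (rstep A S)\<^sup>*\<^sup>* v z))"

definition complete_rs :: "'a set \<Rightarrow> ('a list \<times> 'a list) set \<Rightarrow> bool" where
  "complete_rs A S \<longleftrightarrow> terminating A S \<and> confluent A S"

definition reduced_rs :: "'a set \<Rightarrow> ('a list \<times> 'a list) set \<Rightarrow> bool" where
  "reduced_rs A S \<longleftrightarrow>
     (\<forall>l r. (l, r) \<in> S \<longrightarrow> irreducible_word A S r \<and>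
        (\<forall>l' r'. (l', r') \<in> S \<and> (l', r') \<noteq> (l, r) \<longrightarrow> \<not> sublist l' l))"

definition cyc_conj :: "'a list \<Rightarrow> 'a list \<Rightarrow> bool"  (infix \<open>\<bumpeq>\<close> 50) where
  "u \<bumpeq> v \<longleftrightarrow> (\<exists>p q. u = p @ q \<and> v = q @ p)"

definition cstep :: "'a set \<Rightarrow> ('a list \<times> 'a list) set \<Rightarrow> 'a list \<Rightarrow> 'a list \<Rightarrow> bool" where
  "cstep A S u v \<longleftrightarrow> (\<exists>u'. u' \<bumpeq> u \<and> rstep A S u' v)"

definition cyc_terminating :: "'a set \<Rightarrow> ('a list \<times> 'a list) set \<Rightarrow> bool" where
  "cyc_terminating A S \<longleftrightarrow> \<not> (\<exists>f :: nat \<Rightarrow> 'a list. \<forall>i. cstep A S (f i) (f (Suc i)))"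

definition cyc_confluent :: "'a set \<Rightarrow> ('a list \<times> 'a list) set \<Rightarrow> bool" where
  "cyc_confluent A S \<longleftrightarrow>
     (\<forall>w\<in>lists A. \<forall>u v. (cstep A S)\<^sup>*\<^sup>* w u \<and> (cstep A S)\<^sup>*\<^sup>* w v \<longrightarrow>
        (\<exists>z z'. z \<bumpeq> z' \<and> (cstep A S)\<^sup>*\<^sup>* u z \<and> (cstep A S)\<^sup>*\<^sup>* v z'))"

definition cyc_complete :: "'a set \<Rightarrow> ('a list \<times> 'a list) set \<Rightarrow> bool" where
  "cyc_complete A S \<longleftrightarrow> cyc_terminating A S \<and> cyc_confluent A S"

definition cyc_irreducible :: "'a set \<Rightarrow> ('a list \<times> 'a list) set \<Rightarrow> 'a list \<Rightarrow> bool" where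
  "cyc_irreducible A S w \<longleftrightarrow>
     irreducible_word A S w \<and> (\<forall>w'. w' \<bumpeq> w \<longrightarrow> irreducible_word A S w')"

text \<open>\<open>cyc_irr_form A S u v\<close>: the word \<open>v\<close> is a representative of \<open>\<rho>(u)\<close>, which is only
  defined up to \<open>\<bumpeq>\<close>.\<close>

definition cyc_irr_form :: "'a set \<Rightarrow> ('a list \<times> 'a list) set \<Rightarrow> 'a list \<Rightarrow> 'a list \<Rightarrow> bool" where
  "cyc_irr_form A S u v \<longleftrightarrow> (cstep A S)\<^sup>*\<^sup>* u v \<and> cyc_irreducible A S v"

definition transposed :: "'a set \<Rightarrow> ('a list \<times> 'a list) set \<Rightarrow> 'a list \<Rightarrow> 'a list \<Rightarrow> bool" where
  "transposed A R u v \<longleftrightarrow>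
     (\<exists>x\<in>lists A. \<exists>y\<in>lists A. eq_mon A R u (x @ y) \<and> eq_mon A R v (y @ x))"

definition conj_mon :: "'a set \<Rightarrow> ('a list \<times> 'a list) set \<Rightarrow> 'a list \<Rightarrow> 'a list \<Rightarrow> bool" where
  "conj_mon A R u v \<longleftrightarrow>
     (\<exists>x\<in>lists A. \<exists>y\<in>lists A. eq_mon A R (u @ x) (x @ v) \<and> eq_mon A R (y @ u) (v @ y))"

lemma cyc_irreducible_no_cstep: "cyc_irreducible A S w \<longleftrightarrow> \<not> (\<exists>v. cstep A S w v)"
proof -
  have "w \<bumpeq> w" unfolding cyc_conj_def by (metis append_Nil append_Nil2)
  then show ?thesis
    unfolding cyc_irreducible_def cstep_def irreducible_word_def by blast
qed

lemma cyc_irr_form_exists: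
  assumes "cyc_terminating A S"
  shows "\<exists>v. cyc_irr_form A S u v"
proof (rule ccontr)
  assume no: "\<nexists>v. cyc_irr_form A S u v"
  let ?P = "\<lambda>w. (cstep A S)\<^sup>*\<^sup>* u w"
  have "\<exists>v. ?P v \<and> cstep A S w v" if "?P w" for w
    using no that unfolding cyc_irr_form_def cyc_irreducible_no_cstep
    by (meson rtranclp.rtrancl_into_rtrancl)
  then obtain f where "\<And>n :: nat. ?P (f n) \<and> cstep A S (f n) (f (Suc n))"
    using dependent_nat_choice[of "\<lambda>_. ?P" "\<lambda>_. cstep A S"] by blast
  then show False using assms unfolding cyc_terminating_def by blast
qed

lemma cyc_irr_form_unique:
  assumes "cyc_confluent A S" "u \<in> lists A" "cyc_irr_form A S u v" "cyc_irr_form A S u w"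
  shows "v \<bumpeq> w"
proof -
  obtain z z' where z: "z \<bumpeq> z'" "(cstep A S)\<^sup>*\<^sup>* v z" "(cstep A S)\<^sup>*\<^sup>* w z'"
    using assms unfolding cyc_confluent_def cyc_irr_form_def by meson
  have "v = z" "w = z'"
    using z assms(3,4) unfolding cyc_irr_form_def cyc_irreducible_no_cstep
    by (meson converse_rtranclpE)+
  with z show ?thesis by simp
qed

end

theory Submission imports Defs begin

text \<open>Words that are equal in \<open>M\<close> have a common descendant under \<open>\<rightarrow>\<close> by the Church--Rosser
  property, and \<open>\<rightarrow>\<close> is contained in \<open>\<looparrowright>\<close>; moreover cyclic conjugates have the same
  \<open>\<looparrowright>\<close>-successors. Uniqueness of \<open>\<rho>\<close> up to \<open>\<bumpeq>\<close> therefore makes \<open>\<rho>\<close> invariant under equality in \<open>M\<close>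
  and under cyclic conjugation, hence under transposition. Conversely, both cyclic conjugation
  and rewriting preserve the class of a word under the equivalence relation \<open>\<equiv>\<^sub>M\<close>, so
  \<open>u \<equiv>\<^sub>M \<rho>(u) \<equiv>\<^sub>M \<rho>(v) \<equiv>\<^sub>M v\<close>.\<close>

lemma cyc_conj_refl: "u \<bumpeq> u"
  unfolding cyc_conj_def by (metis append_Nil append_Nil2)

lemma cyc_conj_sym: "u \<bumpeq> v \<Longrightarrow> v \<bumpeq> u"
  unfolding cyc_conj_def by blast

text \<open>Rotations compose, so this form yields transitivity of \<open>\<bumpeq>\<close> without
  comparing where two factorizations of the middle word overlap.\<close>

lemma cyc_conj_iff_rotate: "u \<bumpeq> v \<longleftrightarrow> (\<exists>n. v = rotate n u)"
proof
  assume "u \<bumpeq> v"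
  then show "\<exists>n. v = rotate n u"
    unfolding cyc_conj_def by (metis rotate_append)
next
  assume "\<exists>n. v = rotate n u"
  then show "u \<bumpeq> v"
    unfolding cyc_conj_def by (metis append_take_drop_id rotate_drop_take)
qed

lemma cyc_conj_trans: "u \<bumpeq> v \<Longrightarrow> v \<bumpeq> w \<Longrightarrow> u \<bumpeq> w"
  unfolding cyc_conj_iff_rotate by (metis rotate_rotate)

lemma rstep_imp_cstep: "rstep A S u v \<Longrightarrow> cstep A S u v"
  unfolding cstep_def using cyc_conj_refl by blast

lemma rsteps_imp_csteps: "(rstep A S)\<^sup>*\<^sup>* u v \<Longrightarrow> (cstep A S)\<^sup>*\<^sup>* u v"
  by (metis mono_rtranclp rstep_imp_cstep)

lemma cstep_cyc_conj: "cstep A S u w \<Longrightarrow> u \<bumpeq> v \<Longrightarrow> cstep A S v w"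
  unfolding cstep_def using cyc_conj_trans by blast

lemma cyc_irr_form_cyc_conj:
  assumes "cyc_irr_form A S u w" "u \<bumpeq> v"
  shows "\<exists>w'. w \<bumpeq> w' \<and> cyc_irr_form A S v w'"
proof -
  have "(cstep A S)\<^sup>*\<^sup>* u w" using assms(1) by (simp add: cyc_irr_form_def)
  then show ?thesis
  proof (cases rule: converse_rtranclpE)
    \<comment> \<open>No step is taken, so \<open>u = w\<close>. Then \<open>v\<close> admits no
      cyclic step either, and the witness is \<open>v\<close> itself.\<close>
    case base
    then have "cyc_irreducible A S v"
      using assms cstep_cyc_conj cyc_conj_sym
      unfolding cyc_irr_form_def cyc_irreducible_no_cstep by blast
    with base assms(2) show ?thesis unfolding cyc_irr_form_def by blast
  next
    \<comment> \<open>The first step can start at \<open>v\<close> instead of \<open>u\<close>. The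
      rest of the chain is unchanged, so the witness is \<open>w\<close>.\<close>
    case (step x)
    then have "(cstep A S)\<^sup>*\<^sup>* v w"
      using assms(2) cstep_cyc_conj by (metis converse_rtranclp_into_rtranclp)
    with assms(1) show ?thesis unfolding cyc_irr_form_def using cyc_conj_refl by blast
  qed
qed

lemma rstep_append:
  assumes "rstep A S u v" "a \<in> lists A" "b \<in> lists A"
  shows "rstep A S (a @ u @ b) (a @ v @ b)"
proof -
  obtain l r p q where "p \<in> lists A" "q \<in> lists A" "(l, r) \<in> S" "u = p @ l @ q" "v = p @ r @ q"
    using assms(1) unfolding rstep_def by blast
  moreover have "a @ p \<in> lists A" "q @ b \<in> lists A" using calculation assms by auto
  ultimately show ?thesis unfolding rstep_def by (metis append.assoc)
qed

lemma rsteps_append: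
  assumes "(rstep A S)\<^sup>*\<^sup>* u v" "a \<in> lists A" "b \<in> lists A"
  shows "(rstep A S)\<^sup>*\<^sup>* (a @ u @ b) (a @ v @ b)"
  using assms(1)
proof induction
  case (step v w)
  then show ?case using rstep_append[OF step.hyps(2) assms(2,3)] by simp
qed simp

lemma gen_cong_in_lists:
  "(u, v) \<in> gen_cong A R \<Longrightarrow> u \<in> lists A \<and> v \<in> lists A"
  by (induction rule: gen_cong.induct) auto

lemma rstep_imp_gen_cong:
  assumes "S \<subseteq> lists A \<times> lists A" "rstep A S u v"
  shows "(u, v) \<in> gen_cong A S"
proof -
  obtain l r p q where *: "p \<in> lists A" "q \<in> lists A" "(l, r) \<in> S" "u = p @ l @ q" "v = p @ r @ q"
    using assms(2) unfolding rstep_def by blast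
  then have "(l, r) \<in> gen_cong A S" using assms(1) by (auto intro: gen_cong.base)
  with * show ?thesis by (simp only: gen_cong.mult gen_cong.refl)
qed

lemma rsteps_in_lists:
  assumes "S \<subseteq> lists A \<times> lists A" "(rstep A S)\<^sup>*\<^sup>* u v" "u \<in> lists A"
  shows "v \<in> lists A"
  using assms(2,3)
  by induction (auto dest: rstep_imp_gen_cong[OF assms(1)] gen_cong_in_lists)

text \<open>Induction on the generation of the congruence: confluence closes the transitivity case,
  and products are joined by reducing one factor after the other.\<close>

lemma church_rosser:
  assumes S: "S \<subseteq> lists A \<times> lists A" and conf: "confluent A S"
    and "(u, v) \<in> gen_cong A S"
  shows "\<exists>z. (rstep A S)\<^sup>*\<^sup>* u z \<and> (rstep A S)\<^sup>*\<^sup>* v z"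
  using assms(3)
proof induction
  case (base l r)
  have "[] \<in> lists A" by simp
  with base(1) have "rstep A S l r" unfolding rstep_def by (metis append_Nil append_Nil2)
  then show ?case by blast
next
  case (trans u v w)
  then obtain z z' where z: "(rstep A S)\<^sup>*\<^sup>* u z" "(rstep A S)\<^sup>*\<^sup>* v z"
      "(rstep A S)\<^sup>*\<^sup>* v z'" "(rstep A S)\<^sup>*\<^sup>* w z'" by blast
  have "v \<in> lists A" using trans.hyps gen_cong_in_lists by blast
  \<comment> \<open>Both \<open>z\<close> and \<open>z'\<close> descend from the middle word
    \<open>v\<close>, which lies over \<open>A\<close> as confluence requires.\<close>
  then obtain y where "(rstep A S)\<^sup>*\<^sup>* z y" "(rstep A S)\<^sup>*\<^sup>* z' y"
    using conf z unfolding confluent_def by blast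
  with z show ?case by (meson rtranclp_trans)
next
  case (mult u v u' v')
  then obtain z z' where z: "(rstep A S)\<^sup>*\<^sup>* u z" "(rstep A S)\<^sup>*\<^sup>* v z"
      "(rstep A S)\<^sup>*\<^sup>* u' z'" "(rstep A S)\<^sup>*\<^sup>* v' z'" by blast
  have in_A: "u \<in> lists A" "v \<in> lists A" "u' \<in> lists A" "v' \<in> lists A"
    using mult.hyps gen_cong_in_lists by blast+
  \<comment> \<open>The left factor is reduced with \<open>b\<close> as right context, then the
    right factor with \<open>z\<close> as left context. Contexts of \<open>rstep\<close> must lie
    over \<open>A\<close>, so \<open>z\<close> has to be shown to lie there.\<close>
  have join: "(rstep A S)\<^sup>*\<^sup>* (a @ b) (z @ z')"
    if "(rstep A S)\<^sup>*\<^sup>* a z" "(rstep A S)\<^sup>*\<^sup>* b z'" "a \<in> lists A" "b \<in> lists A" for a b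
  proof -
    have "(rstep A S)\<^sup>*\<^sup>* (a @ b) (z @ b)"
      using rsteps_append[OF that(1), of "[]" b] that by simp
    moreover have "(rstep A S)\<^sup>*\<^sup>* (z @ b) (z @ z')"
      using rsteps_append[OF that(2), of z "[]"] rsteps_in_lists[OF S that(1,3)] by simp
    ultimately show ?thesis by simp
  qed
  show ?case using join z in_A by blast
qed blast+

lemma gen_cong_imp_cyc_irr_forms_conj:
  assumes S: "S \<subseteq> lists A \<times> lists A" and conf: "confluent A S" and cyc: "cyc_complete A S"
    and uv: "(u, v) \<in> gen_cong A S"
    and u': "cyc_irr_form A S u u'" and v': "cyc_irr_form A S v v'"
  shows "u' \<bumpeq> v'"
proof -
  have cyc': "cyc_terminating A S" "cyc_confluent A S"
    using cyc unfolding cyc_complete_def by auto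
  obtain z where z: "(rstep A S)\<^sup>*\<^sup>* u z" "(rstep A S)\<^sup>*\<^sup>* v z"
    using church_rosser[OF S conf uv] by blast
  \<comment> \<open>A form of the common descendant \<open>z\<close> is a form of both
    \<open>u\<close> and \<open>v\<close>, so uniqueness compares \<open>u'\<close> and
    \<open>v'\<close> with it.\<close>
  obtain t where t: "cyc_irr_form A S z t" using cyc_irr_form_exists[OF cyc'(1)] by blast
  have "cyc_irr_form A S u t" "cyc_irr_form A S v t"
    using z[THEN rsteps_imp_csteps] t unfolding cyc_irr_form_def by auto
  then have "u' \<bumpeq> t" "t \<bumpeq> v'"
    using cyc_irr_form_unique[OF cyc'(2)] u' v' gen_cong_in_lists[OF uv] by blast+
  then show ?thesis by (rule cyc_conj_trans)
qed

lemma transposed_imp_cyc_irr_forms_conj: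
  assumes S: "S \<subseteq> lists A \<times> lists A" and conf: "confluent A S" and cyc: "cyc_complete A S"
    and uv: "transposed A S u v"
    and u': "cyc_irr_form A S u u'" and v': "cyc_irr_form A S v v'"
  shows "u' \<bumpeq> v'"
proof -
  obtain x y where xy: "(u, x @ y) \<in> gen_cong A S" "(v, y @ x) \<in> gen_cong A S"
    using uv unfolding transposed_def eq_mon_def by blast
  obtain s where s: "cyc_irr_form A S (x @ y) s"
    using cyc_irr_form_exists cyc unfolding cyc_complete_def by blast
  have "x @ y \<bumpeq> y @ x" unfolding cyc_conj_def by blast
  then obtain t where t: "s \<bumpeq> t" "cyc_irr_form A S (y @ x) t"
    using cyc_irr_form_cyc_conj[OF s] by blast
  have "u' \<bumpeq> s" "v' \<bumpeq> t"
    using gen_cong_imp_cyc_irr_forms_conj[OF S conf cyc] xy u' v' s t by blast+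
  with t(1) show ?thesis by (meson cyc_conj_sym cyc_conj_trans)
qed

lemma conj_mon_sym: "conj_mon A R u v \<Longrightarrow> conj_mon A R v u"
  unfolding conj_mon_def eq_mon_def by (meson gen_cong.sym)

text \<open>Conjugators multiply, the second pair in reverse order:
  \<open>u x x' = x v x' = x x' w\<close> and \<open>y' y u = y' v y = w y' y\<close>.\<close>

lemma conj_mon_trans:
  assumes "conj_mon A R u v" "conj_mon A R v w"
  shows "conj_mon A R u w"
proof -
  obtain x y where xy: "x \<in> lists A" "y \<in> lists A"
      "(u @ x, x @ v) \<in> gen_cong A R" "(y @ u, v @ y) \<in> gen_cong A R"
    using assms(1) unfolding conj_mon_def eq_mon_def by blast
  obtain x' y' where xy': "x' \<in> lists A" "y' \<in> lists A"
      "(v @ x', x' @ w) \<in> gen_cong A R" "(y' @ v, w @ y') \<in> gen_cong A R"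
    using assms(2) unfolding conj_mon_def eq_mon_def by blast
  have "((u @ x) @ x', (x @ v) @ x') \<in> gen_cong A R" "(x @ v @ x', x @ x' @ w) \<in> gen_cong A R"
    "(y' @ y @ u, y' @ v @ y) \<in> gen_cong A R" "((y' @ v) @ y, (w @ y') @ y) \<in> gen_cong A R"
    using xy xy' by (simp_all only: gen_cong.mult gen_cong.refl)
  then have "(u @ (x @ x'), (x @ x') @ w) \<in> gen_cong A R"
    "((y' @ y) @ u, w @ (y' @ y)) \<in> gen_cong A R"
    by (simp_all only: append.assoc) (erule (1) gen_cong.trans)+
  moreover have "x @ x' \<in> lists A" "y' @ y \<in> lists A" using xy xy' by auto
  ultimately show ?thesis unfolding conj_mon_def eq_mon_def by blast
qed

lemma gen_cong_imp_conj_mon: "(u, v) \<in> gen_cong A R \<Longrightarrow> conj_mon A R u v"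
  unfolding conj_mon_def eq_mon_def by (auto intro!: bexI[of _ "[]"])

text \<open>If \<open>u = p @ q\<close> and \<open>v = q @ p\<close>, the conjugators are
  \<open>p\<close> and \<open>q\<close>. Both identities already hold between words, so
  \<open>R\<close> is arbitrary.\<close>

lemma cyc_conj_imp_conj_mon:
  assumes "u \<bumpeq> v" "u \<in> lists A"
  shows "conj_mon A R u v"
proof -
  obtain p q where pq: "u = p @ q" "v = q @ p" using assms(1) unfolding cyc_conj_def by blast
  then have "p \<in> lists A" "q \<in> lists A" "u @ p = p @ v" "q @ u = v @ q"
    "p @ v \<in> lists A" "v @ q \<in> lists A"
    using assms(2) by auto
  then show ?thesis unfolding conj_mon_def eq_mon_def by (metis gen_cong.refl)
qed

lemma cstep_imp_conj_mon:
  assumes S: "S \<subseteq> lists A \<times> lists A" and "cstep A S u v"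
  shows "conj_mon A S u v" "v \<in> lists A"
proof -
  obtain w where w: "w \<bumpeq> u" "rstep A S w v" using assms(2) unfolding cstep_def by blast
  \<comment> \<open>Besides the equality, this puts \<open>w\<close> in \<open>lists A\<close>,
    although nothing is assumed about \<open>u\<close>.\<close>
  then have wv: "(w, v) \<in> gen_cong A S" using rstep_imp_gen_cong[OF S] by blast
  then show "v \<in> lists A" using gen_cong_in_lists by blast
  have "conj_mon A S w u"
    using w(1) gen_cong_in_lists[OF wv] by (simp add: cyc_conj_imp_conj_mon)
  then show "conj_mon A S u v"
    using gen_cong_imp_conj_mon[OF wv] by (metis conj_mon_sym conj_mon_trans)
qed

lemma csteps_imp_conj_mon:
  assumes S: "S \<subseteq> lists A \<times> lists A" and "(cstep A S)\<^sup>*\<^sup>* u v" "u \<in> lists A"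
  shows "conj_mon A S u v \<and> v \<in> lists A"
  using assms(2)
proof induction
  case base
  show ?case using assms(3) by (simp add: cyc_conj_imp_conj_mon cyc_conj_refl)
next
  case (step v w)
  then show ?case using cstep_imp_conj_mon[OF S step.hyps(2)] by (auto intro: conj_mon_trans)
qed

theorem theorem3p5:
  fixes A :: "'a set" and R S :: "('a list \<times> 'a list) set" and u v \<rho>u \<rho>v :: "'a list"
  assumes "finite_presentation A R"
    and "rewriting_system_for A R S"
    and "complete_rs A S" and "reduced_rs A S" and "cyc_complete A S"
    and "u \<in> lists A" and "v \<in> lists A"
    and "cyc_irr_form A S u \<rho>u" and "cyc_irr_form A S v \<rho>v"
  shows "(transposed A R u v \<longrightarrow> \<rho>u \<bumpeq> \<rho>v) \<and> (\<rho>u \<bumpeq> \<rho>v \<longrightarrow> conj_mon A R u v)"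
proof (intro conjI impI)
  \<comment> \<open>\<open>R\<close> and \<open>S\<close> present the same equality of words, so
    both claims can be proved for \<open>S\<close>, whose rewriting steps are at hand.\<close>
  have S: "S \<subseteq> lists A \<times> lists A" and eq: "eq_mon A R = eq_mon A S"
    using assms(2) by (auto simp: rewriting_system_for_def eq_mon_def fun_eq_iff)
  have conf: "confluent A S" using assms(3) unfolding complete_rs_def by blast
  show "\<rho>u \<bumpeq> \<rho>v" if "transposed A R u v"
  proof -
    have "transposed A S u v" using that unfolding transposed_def eq .
    then show ?thesis
      using transposed_imp_cyc_irr_forms_conj[OF S conf assms(5)] assms(8,9) by blast
  qed
  show "conj_mon A R u v" if "\<rho>u \<bumpeq> \<rho>v"
  proof -
    have "conj_mon A S u \<rho>u" "\<rho>u \<in> lists A" "conj_mon A S v \<rho>v"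
      using csteps_imp_conj_mon[OF S] assms(6-9) unfolding cyc_irr_form_def by blast+
    moreover have "conj_mon A S \<rho>u \<rho>v"
      using that \<open>\<rho>u \<in> lists A\<close> by (rule cyc_conj_imp_conj_mon)
    ultimately have "conj_mon A S u v"
      by (metis conj_mon_sym conj_mon_trans)
    then show ?thesis unfolding conj_mon_def eq .
  qed
qed

end
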